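(* The following assertions hold: (i) the family of sets $\{\mathfrak{M}_\beta\}_{\beta\in(-\infty,1]}$ is a filtration of $\mathcal{G}_0$; (ii) the filtration $\{\mathfrak{M}_\beta\}_{\beta\in[0,1]}$ is strict.
   Context: Let $\mathbb{D}$ be the open unit disk. $\mathcal{A}$ is the set of holomorphic $f:\mathbb{D}\to\mathbb{C}$ with $f(0)=0$, $f'(0)=1$; quotients such as $f(z)/z$ and $zf'(z)/f(z)$ are extended by their limits at $0$. $\mathcal{G}_0=\{f\in\mathcal{A}:\operatorname{Re}(f(z)/z)>0,\ z\in\mathbb{D}\}$. For $\beta\in\mathbb{R}$, $\mathfrak{M}_\beta$ is the set of $f\in\mathcal{A}$ such that $f(z)f'(z)\ne0$ for all $z\in\mathbb{D}\setminus\{0\}$ and $$\operatorname{Re}\left[\beta\frac{zf'(z)}{f(z)}+(1-\beta)\left(1+\frac{zf''(z)}{f'(z)}\right)\right]>\frac\beta2,\quad z\in\mathbb{D}.$$ A filtration of $\mathcal{G}_0$ (indexed by a connected $J\subset\mathbb{R}$) is a family $\{\mathfrak{F}_s\}_{s\in J}$ of subsets of $\mathcal{G}_0$ with $\mathfrak{F}_s\subseteq\mathfrak{F}_t$ for $s\le t$. It is strict if $\mathfrak{F}_s\subsetneq\mathfrak{F}_t$ for $s<t$, $s,t\in J$. *)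

theory Defs
  imports "HOL-Complex_Analysis.Complex_Analysis"
begin

text \<open>Functions on the open unit disk are represented by total functions on the complex
  plane. All the conditions below only depend on the values in the disk.\<close>

definition unit_disk :: "complex set" where
  "unit_disk = ball 0 1"

definition class_A :: "(complex \<Rightarrow> complex) set" where
  "class_A = {f. f holomorphic_on unit_disk \<and> f 0 = 0 \<and> deriv f 0 = 1}"

text \<open>Extension by the limit at \<open>0\<close>. It is needed because quotients such as \<open>f z / z\<close>
  evaluate to \<open>0\<close> at \<open>z = 0\<close> under the convention \<open>x / 0 = 0\<close>.\<close>

definition ext0 :: "(complex \<Rightarrow> complex) \<Rightarrow> complex \<Rightarrow> complex" where
  "ext0 g z = (if z = 0 then Lim (at 0) g else g z)"

definition G0 :: "(complex \<Rightarrow> complex) set" where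
  "G0 = {f \<in> class_A. \<forall>z\<in>unit_disk. Re (ext0 (\<lambda>w. f w / w) z) > 0}"

definition M_class :: "real \<Rightarrow> (complex \<Rightarrow> complex) set" where
  "M_class \<beta> = {f \<in> class_A.
     (\<forall>z\<in>unit_disk - {0}. f z * deriv f z \<noteq> 0) \<and>
     (\<forall>z\<in>unit_disk.
        Re (of_real \<beta> * ext0 (\<lambda>w. w * deriv f w / f w) z
            + of_real (1 - \<beta>) * (1 + z * deriv (deriv f) z / deriv f z)) > \<beta> / 2)}"

definition filtration :: "'a set \<Rightarrow> real set \<Rightarrow> (real \<Rightarrow> 'a set) \<Rightarrow> bool" where
  "filtration G J F \<longleftrightarrow>
     connected J \<and> (\<forall>s\<in>J. F s \<subseteq> G) \<and> (\<forall>s\<in>J. \<forall>t\<in>J. s \<le> t \<longrightarrow> F s \<subseteq> F t)"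

definition strict_filtration :: "'a set \<Rightarrow> real set \<Rightarrow> (real \<Rightarrow> 'a set) \<Rightarrow> bool" where
  "strict_filtration G J F \<longleftrightarrow>
     filtration G J F \<and> (\<forall>s\<in>J. \<forall>t\<in>J. s < t \<longrightarrow> F s \<subset> F t)"

end

theory Submission
  imports Defs
begin

text \<open>
  Put \<open>p = z f' / f\<close>, so that \<open>1 + z f'' / f' = p + z p' / p\<close>. Jack's lemma shows that a
  zero-free \<open>h\<close> with \<open>h 0 = 1\<close> stays in \<open>Re > 1 / 2\<close> as soon as \<open>Re (z h' / h) > - 1 / 2\<close>
  wherever \<open>Re h = 1 / 2\<close>. For \<open>h = p\<close> this gives \<open>M_class \<beta> \<subseteq> M_class 1\<close>, and for \<open>h = f / z\<close>
  it gives \<open>M_class 1 \<subseteq> G0\<close>. The inequality defining \<open>M_class \<beta>\<close> is affine in \<open>\<beta>\<close>, so the one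
  for \<open>t\<close> between \<open>s\<close> and \<open>1\<close> is a convex combination of those for \<open>s\<close> and \<open>1\<close>.
  Strictness is witnessed by \<open>z exp (a z)\<close> with a suitable \<open>a\<close> between \<open>1 / 3\<close> and \<open>1 / 2\<close>.
\<close>

section \<open>Jack's lemma and the half-plane criterion\<close>

lemma has_real_derivative_norm_power2:
  fixes \<phi> :: "real \<Rightarrow> complex"
  assumes "(\<phi> has_vector_derivative d) (at a)"
  shows "((\<lambda>x. (norm (\<phi> x))\<^sup>2) has_real_derivative 2 * Re (cnj (\<phi> a) * d)) (at a)"
proof -
  have Re: "((\<lambda>x. Re (\<phi> x)) has_real_derivative Re d) (at a)"
    and Im: "((\<lambda>x. Im (\<phi> x)) has_real_derivative Im d) (at a)"
    using assms by (auto intro: has_field_derivative_Re has_field_derivative_Im)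
  have "((\<lambda>x. (Re (\<phi> x))\<^sup>2 + (Im (\<phi> x))\<^sup>2) has_real_derivative 2 * Re (cnj (\<phi> a) * d)) (at a)"
    by (rule derivative_eq_intros Re Im refl)+ (simp add: algebra_simps)
  then show ?thesis
    by (simp add: cmod_power2)
qed

text \<open>The factor is \<open>D = z0 * deriv w z0 / w z0\<close>. Along the circle through
  \<open>z0\<close> the modulus of \<open>w\<close> is maximal at \<open>z0\<close>, so its
  tangential derivative vanishes and \<open>D\<close> is real. Along the radius the Schwarz lemma
  makes the modulus grow at least linearly up to \<open>z0\<close>, which gives
  \<open>Re D \<ge> 1\<close>.\<close>

lemma Jack_lemma:
  assumes hol: "w holomorphic_on ball 0 R" and w0: "w 0 = 0"
    and z0: "norm z0 < R" and nz: "w z0 \<noteq> 0"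
    and less: "\<And>z. norm z < norm z0 \<Longrightarrow> norm (w z) < norm (w z0)"
  obtains k :: real where "k \<ge> 1" "z0 * deriv w z0 = of_real k * w z0"
proof -
  define D where "D = z0 * deriv w z0 / w z0"
  have z0_nz: "z0 \<noteq> 0"
    using nz w0 by auto
  \<comment> \<open>Normalised values of \<open>w\<close> along a path through \<open>z0\<close> at
    \<open>x = 0\<close>: the circle for \<open>c = \<i>\<close>, the radius for
    \<open>c = 1\<close>.\<close>
  define \<phi> where "\<phi> c x = w (z0 * exp (c * of_real x)) / w z0" for c :: complex and x :: real
  have norm_arg: "norm (z0 * exp (c * of_real x)) = norm z0 * exp (Re c * x)" for c and x :: real
    by (simp add: norm_mult norm_exp_eq_Re)
  have w_deriv: "(w has_field_derivative deriv w z0) (at z0)"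
    using hol z0 by (intro holomorphic_derivI[of _ "ball 0 R"]) auto
  have \<phi>_deriv: "((\<lambda>x. (norm (\<phi> c x))\<^sup>2) has_real_derivative 2 * Re (D * c)) (at 0)" for c
  proof -
    have 1: "((\<lambda>x. z0 * exp (c * x)) has_field_derivative z0 * c) (at 0)"
      by (rule derivative_eq_intros refl)+ simp
    have "((\<lambda>x. w (z0 * exp (c * x)) / w z0) has_field_derivative D * c) (at (of_real 0))"
      using DERIV_cdivide[OF DERIV_chain2[of w "deriv w z0" "\<lambda>x. z0 * exp (c * x)", OF _ 1], of "w z0"]
        w_deriv by (simp add: D_def mult_ac)
    from has_vector_derivative_real_field[OF this]
    have "(\<phi> c has_vector_derivative D * c) (at 0)"
      unfolding \<phi>_def .
    from has_real_derivative_norm_power2[OF this] show ?thesis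
      using nz by (simp add: \<phi>_def)
  qed
  have schwarz: "norm (w z) \<le> norm (w z0) * (norm z / norm z0)" if z: "norm z < norm z0" for z
  proof -
    \<comment> \<open>Rescaled by \<open>z0\<close> in the argument and by \<open>w z0\<close> in
      the value, \<open>w\<close> becomes a self-map of the unit disk fixing 0.\<close>
    define u where "u \<zeta> = w (z0 * \<zeta>) / w z0" for \<zeta>
    have "u holomorphic_on ball 0 1"
      unfolding u_def using z0 z0_nz nz
      by (intro holomorphic_intros holomorphic_on_compose_gen[OF _ hol, unfolded o_def])
        (auto simp: norm_mult intro!: le_less_trans[OF mult_left_le])
    moreover have "norm (u \<zeta>) < 1" if "norm \<zeta> < 1" for \<zeta>
      using less[of "z0 * \<zeta>"] that z0_nz nz by (simp add: u_def norm_mult norm_divide)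
    ultimately have "norm (u (z / z0)) \<le> norm (z / z0)"
      using z z0_nz by (intro Schwarz_Lemma) (simp_all add: u_def[of 0] w0 norm_divide)
    then show ?thesis
      using z0_nz nz by (simp add: u_def norm_divide field_simps)
  qed
  have circle: "norm (w z) \<le> norm (w z0)" if "norm z = norm z0" for z
  proof (rule continuous_on_closure_norm_le[of "ball 0 (norm z0)" w])
    show "continuous_on (closure (ball 0 (norm z0))) w"
      using z0_nz z0 by (intro holomorphic_on_imp_continuous_on holomorphic_on_subset[OF hol]) auto
    show "\<forall>y\<in>ball 0 (norm z0). norm (w y) \<le> norm (w z0)"
      using less by (auto intro: less_imp_le)
    show "z \<in> closure (ball 0 (norm z0))"
      using that z0_nz by auto
  qed
  have "Im D = 0"
  proof -
    have "(norm (\<phi> \<i> x))\<^sup>2 \<le> (norm (\<phi> \<i> 0))\<^sup>2" for x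
      using circle[of "z0 * exp (\<i> * of_real x)"] nz norm_arg[of \<i> x]
      by (simp add: \<phi>_def norm_divide power_le_one)
    then have "2 * Re (D * \<i>) = 0"
      by (intro DERIV_local_max[OF \<phi>_deriv zero_less_one]) auto
    then show ?thesis by simp
  qed
  moreover have "Re D \<ge> 1"
  proof (rule ccontr)
    assume "\<not> 1 \<le> Re D"
    \<comment> \<open>The weight \<open>exp (- 2 * x)\<close> cancels exactly the growth in the
      Schwarz bound. If \<open>Re D < 1\<close>, the product exceeds 1 just inside the circle,
      whereas \<open>schwarz\<close> bounds it by 1.\<close>
    have "((\<lambda>x. (norm (\<phi> 1 x))\<^sup>2 * exp (- 2 * x)) has_real_derivative 2 * Re D - 2) (at 0)"
      by (rule derivative_eq_intros \<phi>_deriv refl)+ (use nz in \<open>simp add: \<phi>_def\<close>)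
    from DERIV_neg_dec_left[OF this] \<open>\<not> 1 \<le> Re D\<close> obtain d where "d > 0"
      and d: "\<forall>h>0. h < d \<longrightarrow> (norm (\<phi> 1 0))\<^sup>2 < (norm (\<phi> 1 (- h)))\<^sup>2 * exp (2 * h)"
      by auto
    define h where "h = d / 2"
    have "h > 0" "h < d" "norm (\<phi> 1 0) = 1"
      using \<open>d > 0\<close> nz by (auto simp: h_def \<phi>_def)
    with d have h: "h > 0" "1 < (norm (\<phi> 1 (- h)))\<^sup>2 * exp (2 * h)"
      by auto
    have "norm (w (z0 * exp (1 * of_real (- h)))) \<le> norm (w z0) * exp (- h)"
      using schwarz[of "z0 * exp (1 * of_real (- h))"] h z0_nz norm_arg[of 1 "- h"]
      by simp
    then have "norm (\<phi> 1 (- h)) \<le> exp (- h)"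
      using nz by (simp add: \<phi>_def norm_divide field_simps)
    then have "(norm (\<phi> 1 (- h)))\<^sup>2 \<le> (exp (- h))\<^sup>2"
      by (intro power_mono) auto
    also have "\<dots> = exp (- (2 * h))"
      by (simp add: exp_double [symmetric])
    finally have "(norm (\<phi> 1 (- h)))\<^sup>2 * exp (2 * h) \<le> exp (- (2 * h)) * exp (2 * h)"
      by (intro mult_right_mono) auto
    with h show False
      by (simp add: exp_minus)
  qed
  moreover have "z0 * deriv w z0 = D * w z0"
    using nz by (simp add: D_def)
  ultimately show ?thesis
    using that[of "Re D"] by (metis complex_is_Real_iff of_real_Re)
qed

text \<open>\<open>h\<close> lies in the half-plane \<open>Re > 1 / 2\<close> iff \<open>w = 1 - 1 / h\<close> lies in the unit disk; at the
  first point where \<open>\<bar>w\<bar> = 1\<close> Jack's lemma gives \<open>z h' / h = k w / (1 - w) = k (h - 1)\<close>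
  with \<open>k \<ge> 1\<close>.\<close>

lemma Re_gt_half_if_boundary_condition:
  assumes hol: "h holomorphic_on ball 0 1" and h0: "h 0 = 1"
    and nz: "\<And>z. norm z < 1 \<Longrightarrow> h z \<noteq> 0"
    and bd: "\<And>z. norm z < 1 \<Longrightarrow> Re (h z) = 1 / 2 \<Longrightarrow> Re (z * deriv h z / h z) > - 1 / 2"
    and z: "norm z < 1"
  shows "Re (h z) > 1 / 2"
proof (rule ccontr)
  assume neg: "\<not> Re (h z) > 1 / 2"
  define w where "w x = 1 - 1 / h x" for x
  have w_iff: "norm (w x) < 1 \<longleftrightarrow> Re (h x) > 1 / 2" "norm (w x) = 1 \<longleftrightarrow> Re (h x) = 1 / 2"
    if "norm x < 1" for x
  proof -
    have "(norm (h x - 1))\<^sup>2 = (norm (h x))\<^sup>2 + 1 - 2 * Re (h x)"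
      unfolding cmod_power2 by (simp add: power2_eq_square algebra_simps)
    moreover have "norm (w x) = norm (h x - 1) / norm (h x)"
      using nz[OF that] by (simp add: w_def norm_divide[symmetric] field_simps)
    moreover have "norm (h x - 1) < norm (h x) \<longleftrightarrow> (norm (h x - 1))\<^sup>2 < (norm (h x))\<^sup>2"
      by (auto intro: power_strict_mono power_less_imp_less_base)
    moreover have "norm (h x - 1) = norm (h x) \<longleftrightarrow> (norm (h x - 1))\<^sup>2 = (norm (h x))\<^sup>2"
      by simp
    ultimately show "norm (w x) < 1 \<longleftrightarrow> Re (h x) > 1 / 2" "norm (w x) = 1 \<longleftrightarrow> Re (h x) = 1 / 2"
      using nz[OF that] by (simp_all add: mult.commute[of _ 2] eq_commute[of "norm (h x)"])
  qed
  have holw: "w holomorphic_on ball 0 1"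
    unfolding w_def by (intro holomorphic_intros hol) (use nz in auto)
  have w0: "w 0 = 0" by (simp add: w_def h0)
  \<comment> \<open>A point of least modulus in this compact set serves as \<open>z0\<close> in
    Jack's lemma: \<open>norm (w x) < 1\<close> at smaller moduli, and continuity then forces
    \<open>norm (w z0) = 1\<close>.\<close>
  define S where "S = {x \<in> cball 0 (norm z). 1 \<le> norm (w x)}"
  have contw: "continuous_on (cball 0 (norm z)) w"
    using z by (intro holomorphic_on_imp_continuous_on holomorphic_on_subset[OF holw]) auto
  have "closed S"
    unfolding S_def by (intro continuous_closed_preimage_constant continuous_intros contw
      continuous_on_closed_Collect_le closed_cball)
  then have "compact S"
    by (metis (no_types, lifting) S_def bounded_cball bounded_subset compact_eq_bounded_closed mem_Collect_eq subsetI)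
  moreover have "z \<in> S"
    using neg w_iff(1)[OF z] by (auto simp: S_def)
  ultimately obtain z0 where z0: "z0 \<in> S" and min: "\<And>x. x \<in> S \<Longrightarrow> norm z0 \<le> norm x"
    using continuous_attains_inf[of S norm] by (auto intro: continuous_intros)
  have z0_le: "norm z0 \<le> norm z" and z0_lt: "norm z0 < 1" and z0_w: "norm (w z0) \<ge> 1"
    using z0 z by (auto simp: S_def)
  have z0_nz: "z0 \<noteq> 0"
    using z0_w w0 by auto
  have inner: "norm (w x) < 1" if "norm x < norm z0" for x
    using min[of x] that z0_le by (force simp: S_def)
  have "norm (w z0) \<le> 1"
  proof (rule continuous_on_closure_norm_le[of "ball 0 (norm z0)" w])
    show "continuous_on (closure (ball 0 (norm z0))) w"
      using z0_nz z0_le by (intro continuous_on_subset[OF contw]) auto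
    show "\<forall>y\<in>ball 0 (norm z0). norm (w y) \<le> 1"
      using inner by (auto intro: less_imp_le)
    show "z0 \<in> closure (ball 0 (norm z0))"
      using z0_nz by auto
  qed
  with z0_w have wz0: "norm (w z0) = 1" by simp
  obtain k :: real where k: "k \<ge> 1" "z0 * deriv w z0 = of_real k * w z0"
    using Jack_lemma[OF holw w0 z0_lt] inner wz0 by (metis norm_zero zero_neq_one)
  have h_nz: "h z0 \<noteq> 0"
    using nz z0_lt by blast
  have "(h has_field_derivative deriv h z0) (at z0)"
    using hol z0_lt by (intro holomorphic_derivI[of _ "ball 0 1"]) auto
  then have "(w has_field_derivative deriv h z0 / (h z0)\<^sup>2) (at z0)"
    unfolding w_def using h_nz
    by (auto intro!: derivative_eq_intros simp: power2_eq_square field_simps)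
  then have "z0 * deriv h z0 / (h z0)\<^sup>2 = of_real k * (1 - 1 / h z0)"
    using k(2) by (simp add: DERIV_imp_deriv w_def)
  then have "z0 * deriv h z0 / h z0 = of_real k * (h z0 - 1)"
    using h_nz by (simp add: power2_eq_square field_simps)
  then have "Re (z0 * deriv h z0 / h z0) = k * (Re (h z0) - 1)"
    by simp
  \<comment> \<open>The real part above thus equals \<open>- k / 2\<close>, which is at most
    \<open>- 1 / 2\<close> and contradicts \<open>bd\<close>.\<close>
  moreover have "Re (h z0) = 1 / 2"
    using w_iff(2) z0_lt wz0 by blast
  ultimately show False
    using bd[OF z0_lt] k(1) by simp
qed

section \<open>Holomorphic forms of \<open>f z / z\<close> and of the logarithmic derivative\<close>

text \<open>The singularity of \<open>f z / z\<close> at 0 is removable with value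
  \<open>deriv f 0 = 1\<close>. Working with \<open>h\<close> removes \<open>ext0\<close> from later
  arguments.\<close>

lemma class_A_quotient:
  assumes f: "f \<in> class_A"
  obtains h where "h holomorphic_on ball 0 1" "h 0 = 1" "\<And>z. f z = z * h z"
    "\<And>z. norm z < 1 \<Longrightarrow> deriv f z = h z + z * deriv h z"
    "\<And>z. ext0 (\<lambda>w. f w / w) z = h z"
proof -
  define h where "h z = (if z = 0 then 1 else f z / z)" for z
  have f': "f holomorphic_on ball 0 1" "f 0 = 0" "deriv f 0 = 1"
    using f by (auto simp: class_A_def unit_disk_def)
  have hol: "h holomorphic_on ball 0 1"
    using pole_lemma_open[OF f'(1) open_ball, of 0] f' by (simp add: h_def[abs_def] cong: if_cong)
  have eq: "f z = z * h z" for z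
    using f' by (simp add: h_def)
  have "deriv f z = h z + z * deriv h z" if "norm z < 1" for z
  proof -
    have "(h has_field_derivative deriv h z) (at z)"
      using hol that by (intro holomorphic_derivI[of _ "ball 0 1"]) auto
    then have "((\<lambda>z. z * h z) has_field_derivative h z + z * deriv h z) (at z)"
      by (auto intro!: derivative_eq_intros)
    moreover have "f = (\<lambda>z. z * h z)" using eq by auto
    ultimately show ?thesis by (simp add: DERIV_imp_deriv)
  qed
  moreover have "ext0 (\<lambda>w. f w / w) z = h z" for z
  proof (cases "z = 0")
    case True
    have "(f has_field_derivative 1) (at 0)"
      using holomorphic_derivI[OF f'(1), of 0] f' by simp
    then have "((\<lambda>w. f w / w) \<longlongrightarrow> 1) (at 0)"
      using f' by (simp add: has_field_derivative_iff)
    then show ?thesis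
      using True by (simp add: ext0_def h_def tendsto_Lim)
  qed (simp add: ext0_def h_def)
  ultimately show ?thesis
    using that hol eq by (auto simp: h_def)
qed

text \<open>This rewrites the condition defining \<open>M_class\<close> in terms of \<open>p\<close>
  alone. Logarithmic differentiation of \<open>p = f' / h\<close> gives
  \<open>z p' / p = z f'' / f' - z h' / h\<close>, and \<open>z h' / h\<close> is
  \<open>p - 1\<close>.\<close>

lemma class_A_log_derivative:
  assumes f: "f \<in> class_A" and nz: "\<And>z. norm z < 1 \<Longrightarrow> z \<noteq> 0 \<Longrightarrow> f z * deriv f z \<noteq> 0"
  obtains h p where "h holomorphic_on ball 0 1" "h 0 = 1" "\<And>z. norm z < 1 \<Longrightarrow> h z \<noteq> 0"
    "p holomorphic_on ball 0 1" "p 0 = 1" "\<And>z. norm z < 1 \<Longrightarrow> p z \<noteq> 0"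
    "\<And>z. ext0 (\<lambda>w. f w / w) z = h z"
    "\<And>z. norm z < 1 \<Longrightarrow> p z = 1 + z * deriv h z / h z"
    "\<And>z. norm z < 1 \<Longrightarrow> ext0 (\<lambda>w. w * deriv f w / f w) z = p z"
    "\<And>z. norm z < 1 \<Longrightarrow> 1 + z * deriv (deriv f) z / deriv f z = p z + z * deriv p z / p z"
proof -
  obtain h where h: "h holomorphic_on ball 0 1" "h 0 = 1" "\<And>z. f z = z * h z"
    "\<And>z. norm z < 1 \<Longrightarrow> deriv f z = h z + z * deriv h z"
    "\<And>z. ext0 (\<lambda>w. f w / w) z = h z"
    using class_A_quotient[OF f] by blast
  \<comment> \<open>This is \<open>z f' / f\<close> with the factor \<open>z\<close> cancelled, so
    no separate value at 0 is needed.\<close>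
  define p where "p z = deriv f z / h z" for z
  have f': "f holomorphic_on ball 0 1" "deriv f 0 = 1"
    using f by (auto simp: class_A_def unit_disk_def)
  have h_nz: "h z \<noteq> 0" if "norm z < 1" for z
    using nz[OF that] h(2) h(3)[of z] by (cases "z = 0") auto
  have df_nz: "deriv f z \<noteq> 0" if "norm z < 1" for z
    using nz[of z] that f' by (cases "z = 0") auto
  have p_hol: "p holomorphic_on ball 0 1"
    unfolding p_def by (intro holomorphic_intros f' h) (use h_nz in auto)
  have p0: "p 0 = 1" using f' h by (simp add: p_def)
  have p_h: "p z = 1 + z * deriv h z / h z" if "norm z < 1" for z
    using h_nz[OF that] h(4)[OF that] by (simp add: p_def field_simps)
  have p_f: "z * deriv f z / f z = p z" if "z \<noteq> 0" for z
    using that by (simp add: p_def h(3))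
  have ext: "ext0 (\<lambda>w. w * deriv f w / f w) z = p z" for z
  proof (cases "z = 0")
    case True
    have "isCont p 0"
      using holomorphic_on_imp_continuous_on[OF p_hol] by (simp add: continuous_on_eq_continuous_at)
    then have "(p \<longlongrightarrow> 1) (at 0)"
      by (simp add: isCont_def p0)
    then have "((\<lambda>w. w * deriv f w / f w) \<longlongrightarrow> 1) (at 0)"
      by (rule Lim_transform_eventually) (auto simp: p_f eventually_at_filter)
    then show ?thesis
      using True by (simp add: ext0_def p0 tendsto_Lim)
  qed (simp add: ext0_def p_f)
  have "1 + z * deriv (deriv f) z / deriv f z = p z + z * deriv p z / p z" if z: "norm z < 1" for z
  proof -
    have dh: "(h has_field_derivative deriv h z) (at z)"
      using h(1) z by (intro holomorphic_derivI[of _ "ball 0 1"]) auto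
    have ddf: "(deriv f has_field_derivative deriv (deriv f) z) (at z)"
      using f'(1) z by (intro holomorphic_derivI[of _ "ball 0 1"] holomorphic_deriv) auto
    have "deriv p z = (deriv (deriv f) z * h z - deriv f z * deriv h z) / (h z * h z)"
      unfolding p_def by (rule DERIV_imp_deriv DERIV_divide ddf dh h_nz z)+
    then have "deriv p z / p z = deriv (deriv f) z / deriv f z - deriv h z / h z"
      using h_nz[OF z] df_nz[OF z] by (simp add: p_def field_simps)
    then have "z * deriv p z / p z = z * deriv (deriv f) z / deriv f z - z * deriv h z / h z"
      by (metis right_diff_distrib times_divide_eq_right)
    then show ?thesis
      using p_h[OF z] by simp
  qed
  moreover have "p z \<noteq> 0" if "norm z < 1" for z
    using h_nz[OF that] df_nz[OF that] by (simp add: p_def)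
  ultimately show ?thesis
    using that[of h p] h h_nz p_hol p0 p_h ext by blast
qed

section \<open>Inclusions between the classes\<close>

lemma M_class_subset_M_class_1:
  assumes "\<beta> \<le> 1"
  shows "M_class \<beta> \<subseteq> M_class 1"
proof
  fix f assume f: "f \<in> M_class \<beta>"
  have fA: "f \<in> class_A" and nz: "\<And>z. norm z < 1 \<Longrightarrow> z \<noteq> 0 \<Longrightarrow> f z * deriv f z \<noteq> 0"
    using f by (auto simp: M_class_def unit_disk_def)
  obtain h p where "h holomorphic_on ball 0 1" "h 0 = 1" "\<And>z. norm z < 1 \<Longrightarrow> h z \<noteq> 0"
    and p: "p holomorphic_on ball 0 1" "p 0 = 1" "\<And>z. norm z < 1 \<Longrightarrow> p z \<noteq> 0"
    and "\<And>z. ext0 (\<lambda>w. f w / w) z = h z"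
    and "\<And>z. norm z < 1 \<Longrightarrow> p z = 1 + z * deriv h z / h z"
    and ext: "\<And>z. norm z < 1 \<Longrightarrow> ext0 (\<lambda>w. w * deriv f w / f w) z = p z"
    and eq: "\<And>z. norm z < 1 \<Longrightarrow> 1 + z * deriv (deriv f) z / deriv f z = p z + z * deriv p z / p z"
    using class_A_log_derivative[OF fA nz] by blast
  have M: "\<beta> * Re (p z) + (1 - \<beta>) * (Re (p z) + Re (z * deriv p z / p z)) > \<beta> / 2" if "norm z < 1" for z
  proof -
    have "Re (of_real \<beta> * ext0 (\<lambda>w. w * deriv f w / f w) z
            + of_real (1 - \<beta>) * (1 + z * deriv (deriv f) z / deriv f z)) > \<beta> / 2"
      using f that by (auto simp: M_class_def unit_disk_def)
    then show ?thesis
      unfolding ext[OF that] eq[OF that]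
      by (simp only: plus_complex.sel times_complex.sel Re_complex_of_real Im_complex_of_real mult_zero_left diff_zero)
  qed
  have "Re (p z) > 1 / 2" if "norm z < 1" for z
  proof (rule Re_gt_half_if_boundary_condition[OF p _ that])
    fix z :: complex assume z: "norm z < 1" and "Re (p z) = 1 / 2"
    \<comment> \<open>At such a point the \<open>p\<close> terms contribute \<open>1 / 2\<close> in
      total; subtracting \<open>\<beta> / 2\<close> leaves a common factor
      \<open>1 - \<beta>\<close>, which is nonnegative.\<close>
    with M[OF z] have "(1 - \<beta>) * (1 / 2 + Re (z * deriv p z / p z)) > 0"
      by (simp add: algebra_simps)
    then show "Re (z * deriv p z / p z) > - 1 / 2"
      using assms by (simp add: zero_less_mult_iff)
  qed
  then show "f \<in> M_class 1"
    using fA nz ext by (auto simp: M_class_def unit_disk_def)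
qed

text \<open>\<open>M_class 1\<close> consists of functions starlike of order 1/2. Since
  \<open>z h' / h = p - 1\<close>, the boundary condition of the half-plane criterion for
  \<open>h\<close> holds at every point of the disk, and even \<open>Re (f z / z) > 1 / 2\<close>
  follows.\<close>

lemma M_class_1_subset_G0: "M_class 1 \<subseteq> G0"
proof
  fix f assume f: "f \<in> M_class 1"
  have fA: "f \<in> class_A" and nz: "\<And>z. norm z < 1 \<Longrightarrow> z \<noteq> 0 \<Longrightarrow> f z * deriv f z \<noteq> 0"
    and re: "\<And>z. norm z < 1 \<Longrightarrow> Re (ext0 (\<lambda>w. w * deriv f w / f w) z) > 1 / 2"
    using f by (auto simp: M_class_def unit_disk_def)
  obtain h p where h: "h holomorphic_on ball 0 1" "h 0 = 1" "\<And>z. norm z < 1 \<Longrightarrow> h z \<noteq> 0"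
    and "p holomorphic_on ball 0 1" "p 0 = 1" "\<And>z. norm z < 1 \<Longrightarrow> p z \<noteq> 0"
    and ext_h: "\<And>z. ext0 (\<lambda>w. f w / w) z = h z"
    and p_h: "\<And>z. norm z < 1 \<Longrightarrow> p z = 1 + z * deriv h z / h z"
    and ext: "\<And>z. norm z < 1 \<Longrightarrow> ext0 (\<lambda>w. w * deriv f w / f w) z = p z"
    and "\<And>z. norm z < 1 \<Longrightarrow> 1 + z * deriv (deriv f) z / deriv f z = p z + z * deriv p z / p z"
    using class_A_log_derivative[OF fA nz] by blast
  have "Re (h z) > 1 / 2" if "norm z < 1" for z
  proof (rule Re_gt_half_if_boundary_condition[OF h _ that])
    fix z :: complex assume z: "norm z < 1"
    show "Re (z * deriv h z / h z) > - 1 / 2"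
      using re[OF z] p_h[OF z] ext[OF z] by simp
  qed
  then have "Re (ext0 (\<lambda>w. f w / w) z) > 0" if "norm z < 1" for z
    using that ext_h[of z] by (smt (verit) divide_pos_pos)
  then show "f \<in> G0"
    using fA by (auto simp: G0_def unit_disk_def)
qed

lemma M_class_mono:
  assumes "s \<le> t" "t \<le> 1"
  shows "M_class s \<subseteq> M_class t"
proof
  fix f assume f: "f \<in> M_class s"
  have f1: "f \<in> M_class 1"
    using M_class_subset_M_class_1 assms f by (meson order_trans subsetD)
  show "f \<in> M_class t"
  proof (cases "s = 1")
    case False
    have "Re (of_real t * P + of_real (1 - t) * Q) > t / 2"
      if P: "Re (of_real s * P + of_real (1 - s) * Q) > s / 2"
        and Q: "Re (of_real 1 * P + of_real (1 - 1) * Q) > 1 / 2" for P Q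
    proof -
      \<comment> \<open>The weight that makes \<open>t\<close> the convex combination
        \<open>l * s + (1 - l) * 1\<close>.\<close>
      define l where "l = (1 - t) / (1 - s)"
      have s: "s < 1" using assms False by simp
      have l: "0 \<le> l" "l \<le> 1" "l * (1 - s) = 1 - t"
        using assms s by (auto simp: l_def field_simps)
      have t: "t = l * s + (1 - l)" using l(3) by (simp add: algebra_simps)
      have "t * Re P + (1 - t) * Re Q - t / 2
          = l * (s * Re P + (1 - s) * Re Q - s / 2) + (1 - l) * (Re P - 1 / 2)"
        unfolding t by (simp add: field_simps)
      also have "\<dots> > 0"
      \<comment> \<open>Either weight may vanish: strictness comes from \<open>Q\<close> if
        \<open>l = 0\<close>, and from \<open>P\<close> otherwise.\<close>
      proof (cases "l = 0")
        case False
        then show ?thesis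
          using l P Q by (intro add_pos_nonneg mult_pos_pos mult_nonneg_nonneg) auto
      qed (use Q in auto)
      finally show ?thesis by simp
    qed
    then show ?thesis
      using f f1 unfolding M_class_def by blast
  qed (use f f1 assms in auto)
qed

section \<open>Strictness through the functions \<open>z exp (a z)\<close>\<close>

text \<open>The functions \<open>z exp (a z)\<close>, for which \<open>z f' / f = 1 + a z\<close>, separate the classes:
  \<open>M_level \<beta> a\<close> is the infimum over the disk of the expression defining \<open>M_class \<beta>\<close>
  minus \<open>\<beta> / 2\<close>, approached as \<open>z\<close> tends to \<open>-1\<close>.\<close>

definition M_level :: "real \<Rightarrow> real \<Rightarrow> real" where
  "M_level \<beta> a = 1 - a - (1 - \<beta>) * (a / (1 - a)) - \<beta> / 2"

lemma z_exp_class_A: "(\<lambda>z. z * exp (of_real a * z)) \<in> class_A"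
  and deriv_z_exp: "deriv (\<lambda>z. z * exp (of_real a * z)) = (\<lambda>z. (1 + of_real a * z) * exp (of_real a * z))"
  and deriv2_z_exp: "deriv (\<lambda>z. (1 + of_real a * z) * exp (of_real a * z))
        = (\<lambda>z. of_real a * (2 + of_real a * z) * exp (of_real a * z))"
proof -
  show 1: "deriv (\<lambda>z. z * exp (of_real a * z)) = (\<lambda>z. (1 + of_real a * z) * exp (of_real a * z))"
    by (rule ext, rule DERIV_imp_deriv) (auto intro!: derivative_eq_intros simp: algebra_simps)
  show "deriv (\<lambda>z. (1 + of_real a * z) * exp (of_real a * z))
        = (\<lambda>z. of_real a * (2 + of_real a * z) * exp (of_real a * z))"
    by (rule ext, rule DERIV_imp_deriv) (auto intro!: derivative_eq_intros simp: algebra_simps)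
  show "(\<lambda>z. z * exp (of_real a * z)) \<in> class_A"
    unfolding class_A_def by (auto simp: 1 intro!: holomorphic_intros)
qed

lemma ext0_z_exp:
  "ext0 (\<lambda>w. w * deriv (\<lambda>z. z * exp (of_real a * z)) w / (w * exp (of_real a * w))) z = 1 + of_real a * z"
proof (cases "z = 0")
  case True
  have "((\<lambda>w. 1 + of_real a * w) \<longlongrightarrow> 1 + of_real a * (0::complex)) (at 0)"
    by (intro tendsto_intros)
  then have "((\<lambda>w. w * deriv (\<lambda>z. z * exp (of_real a * z)) w / (w * exp (of_real a * w)))
      \<longlongrightarrow> 1 + of_real a * (0::complex)) (at 0)"
    by (rule Lim_transform_eventually) (auto simp: deriv_z_exp eventually_at_filter)
  then show ?thesis
    using True by (simp add: ext0_def tendsto_Lim)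
qed (simp add: ext0_def deriv_z_exp)

text \<open>With \<open>u = 1 + a z\<close>, which has no zero in the disk as \<open>a < 1\<close>,
  one has \<open>p = u\<close> and \<open>z p' / p = 1 - 1 / u\<close>. The condition thus becomes
  one on \<open>u\<close> alone.\<close>

lemma z_exp_in_M_class_iff:
  assumes "0 < a" "a < 1"
  shows "(\<lambda>z. z * exp (of_real a * z)) \<in> M_class \<beta> \<longleftrightarrow>
    (\<forall>z. norm z < 1 \<longrightarrow> Re (1 + of_real a * z) + (1 - \<beta>) * (1 - Re (1 / (1 + of_real a * z))) > \<beta> / 2)"
proof -
  have nz: "1 + of_real a * z \<noteq> 0" if "norm z < 1" for z :: complex
  proof
    assume "1 + of_real a * z = 0"
    then have "norm (of_real a * z) = 1"
      by (metis add_eq_0_iff norm_minus_cancel norm_one)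
    moreover have "norm (of_real a * z) < 1"
      using assms that by (simp add: norm_mult) (smt (verit) mult_left_le)
    ultimately show False by simp
  qed
  have eq: "1 + z * (of_real a * (2 + of_real a * z) * exp (of_real a * z)) / ((1 + of_real a * z) * exp (of_real a * z))
      = (1 + of_real a * z) + (1 - 1 / (1 + of_real a * z))" if "norm z < 1" for z :: complex
  proof -
    define u where "u = 1 + of_real a * z"
    have u: "of_real a * z = u - 1" "u \<noteq> 0"
      using nz[OF that] by (simp_all add: u_def)
    have "1 + z * (of_real a * (2 + of_real a * z) * exp (of_real a * z)) / (u * exp (of_real a * z))
        = 1 + (of_real a * z) * (2 + of_real a * z) / u"
      by simp
    also have "\<dots> = u + (1 - 1 / u)"
      using u(2) unfolding u(1) by (simp add: field_simps)
    finally show ?thesis by (simp add: u_def)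
  qed
  have re: "Re (of_real \<beta> * P + of_real (1 - \<beta>) * (P + (1 - 1 / P))) = Re P + (1 - \<beta>) * (1 - Re (1 / P))" for P
    by (simp only: plus_complex.sel minus_complex.sel times_complex.sel Re_complex_of_real
      Im_complex_of_real one_complex.sel) (simp add: algebra_simps)
  let ?f = "\<lambda>z::complex. z * exp (of_real a * z)"
  have "Re (of_real \<beta> * ext0 (\<lambda>w. w * deriv ?f w / ?f w) z
      + of_real (1 - \<beta>) * (1 + z * deriv (deriv ?f) z / deriv ?f z))
    = Re (1 + of_real a * z) + (1 - \<beta>) * (1 - Re (1 / (1 + of_real a * z)))" if "norm z < 1" for z
    unfolding ext0_z_exp unfolding deriv_z_exp deriv2_z_exp eq[OF that] by (rule re)
  moreover have "\<forall>z. z \<in> ball 0 1 - {0} \<longrightarrow> ?f z * deriv ?f z \<noteq> 0"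
    using nz by (auto simp: deriv_z_exp unit_disk_def)
  ultimately show ?thesis
    by (simp only: M_class_def mem_Collect_eq z_exp_class_A simp_thms Ball_def unit_disk_def
      mem_ball_0 cong: imp_cong)
qed

text \<open>On the disk \<open>Re u > 1 - a\<close> and \<open>Re (1 / u) \<le> 1 / (1 - a)\<close>.
  Inserting both bounds yields \<open>M_level\<close>; the strict first bound allows level
  0.\<close>

lemma z_exp_in_M_class:
  assumes a: "0 < a" "a < 1" and "\<beta> \<le> 1" and level: "M_level \<beta> a \<ge> 0"
  shows "(\<lambda>z. z * exp (of_real a * z)) \<in> M_class \<beta>"
  unfolding z_exp_in_M_class_iff[OF a]
proof (intro allI impI)
  fix z :: complex assume z: "norm z < 1"
  define u where "u = 1 + of_real a * z"
  have "norm (of_real a * z) < a"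
    using z a by (simp add: norm_mult)
  then have re: "Re u > 1 - a"
    using abs_Re_le_cmod[of "of_real a * z"] by (simp add: u_def)
  have "Re (1 / u) \<le> norm (1 / u)"
    by (rule complex_Re_le_cmod)
  also have "\<dots> \<le> 1 / (1 - a)"
    using re a complex_Re_le_cmod[of u] by (simp add: norm_divide frac_le)
  finally have "1 - Re (1 / u) \<ge> - (a / (1 - a))"
    using a by (simp add: field_simps)
  then have "(1 - \<beta>) * (1 - Re (1 / u)) \<ge> (1 - \<beta>) * (- (a / (1 - a)))"
    using \<open>\<beta> \<le> 1\<close> by (intro mult_left_mono) auto
  then show "\<beta> / 2 < Re (1 + of_real a * z) + (1 - \<beta>) * (1 - Re (1 / (1 + of_real a * z)))"
    using re level unfolding u_def M_level_def by linarith
qed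

text \<open>The extremal point -1 is not in the disk. By continuity the level is still negative at
  some \<open>b < a\<close>, and \<open>z = - b / a\<close> attains the level of \<open>b\<close>
  because \<open>a z = - b\<close>.\<close>

lemma z_exp_notin_M_class:
  assumes a: "0 < a" "a < 1" and level: "M_level \<beta> a < 0"
  shows "(\<lambda>z. z * exp (of_real a * z)) \<notin> M_class \<beta>"
proof -
  have "isCont (M_level \<beta>) a"
    unfolding M_level_def using a by (intro continuous_intros) auto
  then have "\<forall>\<^sub>F b in at_left a. M_level \<beta> b < 0"
    using level by (intro order_tendstoD(2)[of _ "M_level \<beta> a"])
      (auto simp: isCont_def filterlim_at_split)
  moreover have "\<forall>\<^sub>F b in at_left a. b \<in> {0<..<a}"
    using a by (intro eventually_at_left_real) auto
  ultimately have "\<forall>\<^sub>F b in at_left a. M_level \<beta> b < 0 \<and> b \<in> {0<..<a}"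
    by (rule eventually_conj)
  then obtain b where b: "M_level \<beta> b < 0" "0 < b" "b < a"
    using eventually_happens'[of "at_left a"] by (auto simp: trivial_limit_at_left_real)
  define z :: complex where "z = of_real (- b / a)"
  have z: "norm z < 1" "1 + of_real a * z = of_real (1 - b)"
    using a b by (auto simp: z_def norm_divide)
  have "Re (1 / complex_of_real (1 - b)) = 1 / (1 - b)"
    by (metis Re_complex_of_real of_real_1 of_real_divide)
  moreover have "1 - 1 / (1 - b) = - (b / (1 - b))"
    using a b by (simp add: field_simps)
  ultimately have "\<not> \<beta> / 2 < Re (1 + of_real a * z) + (1 - \<beta>) * (1 - Re (1 / (1 + of_real a * z)))"
    using b unfolding z(2) M_level_def Re_complex_of_real by simp
  with z(1) show ?thesis
    unfolding z_exp_in_M_class_iff[OF a] by blast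
qed

text \<open>\<open>M_level\<close> is affine in its first argument with slope
  \<open>a / (1 - a) - 1 / 2\<close>, which is zero at \<open>a = 1/3\<close> and positive for
  larger \<open>a < 1\<close>. A zero \<open>a > 1/3\<close> of \<open>M_level t\<close> therefore
  has negative level for \<open>s\<close>, so its function lies in \<open>M_class t\<close> but not
  in \<open>M_class s\<close>.\<close>

lemma M_class_strict_mono:
  assumes "s < t" "t \<le> 1" "0 \<le> t"
  shows "M_class s \<subset> M_class t"
proof -
  have third: "M_level t (1/3) = 1/6"
    by (simp add: M_level_def) argo
  have "M_level t (1/2) = (t - 1) / 2"
    by (simp add: M_level_def)
  moreover have "continuous_on {1/3..1/2} (M_level t)"
    unfolding M_level_def by (intro continuous_intros) auto
  \<comment> \<open>The level is \<open>1/6\<close> at the left end and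
    \<open>(t - 1) / 2 \<le> 0\<close> at the right end.\<close>
  ultimately have "\<exists>a\<ge>1/3. a \<le> 1/2 \<and> M_level t a = 0"
    using assms third by (intro IVT2') auto
  then obtain a where a: "1/3 \<le> a" "a \<le> 1/2" "M_level t a = 0"
    by blast
  with third have "a \<noteq> 1/3" by force
  with a have "1 / 2 - a / (1 - a) < 0"
    by (simp add: field_simps)
  moreover have "M_level s a - M_level t a = (t - s) * (1 / 2 - a / (1 - a))"
    unfolding M_level_def by algebra
  ultimately have "M_level s a < 0"
    using a assms by (simp add: mult_less_0_iff)
  then have "(\<lambda>z. z * exp (of_real a * z)) \<in> M_class t - M_class s"
    using z_exp_in_M_class[of a t] z_exp_notin_M_class[of a s] a assms by auto
  with M_class_mono[of s t] assms show ?thesis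
    by auto
qed

theorem theorem5p25:
  shows "filtration G0 {..1} M_class \<and> strict_filtration G0 {0..1} M_class"
proof -
  have "M_class s \<subseteq> G0" if "s \<le> 1" for s
    using M_class_subset_M_class_1[OF that] M_class_1_subset_G0 by (rule order_trans)
  then show ?thesis
    using M_class_mono M_class_strict_mono
    by (auto simp: filtration_def strict_filtration_def subset_eq intro: connected_Iic connected_Icc)
qed

end
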